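(* Let $n$ be a natural number, and let $1\leq a_1\leq\cdots\leq a_k$ with $k\geq 3$ and $1\leq b_1\leq\cdots\leq b_l$ with $l\geq 3$ be two partitions of $n$ (i.e. $\sum_i a_i=\sum_i b_i=n$). Then $$S(a_1,\dots,a_k)\prec S(b_1,\dots,b_l)\quad\Longleftrightarrow\quad (a_1,\dots,a_k)<^{\mathrm{lex}}(b_1,\dots,b_l).$$
   Context: For a graph $G$ and an integer $k\geq 0$, a walk of length $k$ is a sequence of vertices $v_0,\dots,v_k$ with $v_iv_{i+1}$ an edge for each $i$; it is closed if $v_0=v_k$. $M_k(G)$ denotes the total number of closed walks of length $k$ in $G$ (equivalently the trace of $A(G)^k$, $A(G)$ the adjacency matrix). For graphs $G,H$ write $G\preceq H$ if $M_k(G)\leq M_k(H)$ for all $k\geq 0$, and $G\prec H$ if $G\preceq H$ and $M_{k'}(G)<M_{k'}(H)$ for some $k'\geq 0$. For positive integers $a_1,\dots,a_k$, the starlike tree $S(a_1,\dots,a_k)$ is obtained from the disjoint paths $P_{a_1+1},\dots,P_{a_k+1}$ ($P_m$ the path on $m$ vertices) by identifying one end vertex of each path into a single vertex $u$ (the center), so that removing $u$ leaves paths $P_{a_1},\dots,P_{a_k}$ (the branches, of lengths $a_1,\dots,a_k$). Shortlex order: for finite sequences $a=(a_1,\dots,a_k)$ and $b=(b_1,\dots,b_l)$, $a<^{\mathrm{lex}}b$ if either $k<l$, or $k=l$ and $a_i<b_i$ for the smallest index $i$ with $a_i\neq b_i$. *)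

theory Defs
  imports Main
begin

definition closed_walks :: "'a set \<Rightarrow> ('a \<Rightarrow> 'a \<Rightarrow> bool) \<Rightarrow> nat \<Rightarrow> 'a list set" where
  "closed_walks V E k = {xs. length xs = Suc k \<and> set xs \<subseteq> V \<and>
      (\<forall>i<k. E (xs ! i) (xs ! Suc i)) \<and> hd xs = last xs}"

definition M :: "'a set \<Rightarrow> ('a \<Rightarrow> 'a \<Rightarrow> bool) \<Rightarrow> nat \<Rightarrow> nat" where
  "M V E k = card (closed_walks V E k)"

definition walk_preceq :: "'a set \<Rightarrow> ('a \<Rightarrow> 'a \<Rightarrow> bool) \<Rightarrow> 'b set \<Rightarrow> ('b \<Rightarrow> 'b \<Rightarrow> bool) \<Rightarrow> bool" where
  "walk_preceq V E W F \<longleftrightarrow> (\<forall>k. M V E k \<le> M W F k)"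

definition walk_prec :: "'a set \<Rightarrow> ('a \<Rightarrow> 'a \<Rightarrow> bool) \<Rightarrow> 'b set \<Rightarrow> ('b \<Rightarrow> 'b \<Rightarrow> bool) \<Rightarrow> bool" where
  "walk_prec V E W F \<longleftrightarrow> walk_preceq V E W F \<and> (\<exists>k. M V E k < M W F k)"

text \<open>Vertices: the center, and Br i j = the j-th vertex (1 \<le> j \<le> a_i) on
  branch i (counting from the center), for i < length as.\<close>

datatype svert = Center | Br nat nat

definition star_V :: "nat list \<Rightarrow> svert set" where
  "star_V as = {Center} \<union> {Br i j | i j. i < length as \<and> 1 \<le> j \<and> j \<le> as ! i}"

definition star_edge :: "nat list \<Rightarrow> svert \<Rightarrow> svert \<Rightarrow> bool" where
  "star_edge as u v \<longleftrightarrow>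
     (\<exists>i. i < length as \<and> 1 \<le> as ! i \<and> u = Center \<and> v = Br i 1) \<or>
     (\<exists>i j. i < length as \<and> 1 \<le> j \<and> Suc j \<le> as ! i \<and> u = Br i j \<and> v = Br i (Suc j))"

definition star_E :: "nat list \<Rightarrow> svert \<Rightarrow> svert \<Rightarrow> bool" where
  "star_E as u v \<longleftrightarrow> star_edge as u v \<or> star_edge as v u"

definition shortlex_less :: "nat list \<Rightarrow> nat list \<Rightarrow> bool" where
  "shortlex_less as bs \<longleftrightarrow> (as, bs) \<in> lenlex less_than"

end

theory Submission
  imports Defs "HOL-Computational_Algebra.Formal_Power_Series"
begin

text \<open>
  Deleting a vertex \<open>v\<close> whose closed walks have generating function \<open>g\<close> lowers the generating function
  of all closed walks by \<open>1 + X g' / g\<close>. Removing the center and then the branches of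
  \<open>S(a)\<close> vertex by vertex yields \<open>\<Sum>k. M_k X^k = 1 + n - X D' / D\<close>, where
  \<open>D = \<Prod>i. P(a_i) * (1 - X^2 * \<Sum>i. f(a_i))\<close>, \<open>P(m) = det (1 - X A)\<close> for the path on \<open>m\<close> vertices
  and \<open>f(m) = P(m - 1) / P(m)\<close>. If \<open>D2 = D1 * (1 - E)\<close> where \<open>E\<close> has nonnegative
  coefficients and no constant term, then passing from \<open>D1\<close> to \<open>D2\<close> decreases no coefficient of
  \<open>- X D' / D\<close>, and increases one unless \<open>E = 0\<close>.

  The elementary step goes from \<open>(c, x, y_1, \<dots>, y_r)\<close> with all \<open>y_i \<ge> p = x + 1\<close> to
  \<open>(c, p, \<dots>, p, z)\<close> with \<open>r\<close> copies of \<open>p\<close>. Put \<open>q = z + 1\<close> and let \<open>C\<close> be the sum of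
  \<open>f\<close> over \<open>c\<close>. Up to the factor of \<open>c\<close>, the two determinants are
  \<open>P(p) * \<Prod>i. P(y_i) * (1 - X^2 f(p) (C + \<Sum>i. f(y_i)))\<close> and
  \<open>P(p)^r * P(q) * (1 - X^2 f(q) (C + r f(p)))\<close>. Between them one interpolates by weighted
  graphs: the \<open>y_i\<close> are cut down to \<open>p\<close> one after the other, each handing its weight and its surplus
  vertices to the longest branch, and finally the roles of \<open>f(p)\<close> and \<open>f(q)\<close> are exchanged. Each
  of these moves has the form \<open>D1 * (1 - E)\<close>. Padding the shorter sequence with zeros turns
  shortlex into lexicographic order, and elementary steps connect any two comparable sequences.
\<close>

section \<open>Coefficientwise order and logarithmic derivatives\<close>

definition fps_nonneg :: "real fps \<Rightarrow> bool" where
  "fps_nonneg A \<longleftrightarrow> (\<forall>n. 0 \<le> fps_nth A n)"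

lemma fps_nonneg_simps [simp, intro]:
  "fps_nonneg 0" "fps_nonneg 1" "fps_nonneg fps_X" "fps_nonneg (of_nat m)"
  by (auto simp: fps_nonneg_def fps_of_nat[symmetric])

lemma fps_nonneg_add [intro]: "fps_nonneg A \<Longrightarrow> fps_nonneg B \<Longrightarrow> fps_nonneg (A + B)"
  by (auto simp: fps_nonneg_def)

lemma fps_nonneg_mult [intro]: "fps_nonneg A \<Longrightarrow> fps_nonneg B \<Longrightarrow> fps_nonneg (A * B)"
  by (auto simp: fps_nonneg_def fps_mult_nth intro!: sum_nonneg)

lemma fps_nonneg_power [intro]: "fps_nonneg A \<Longrightarrow> fps_nonneg (A ^ n)"
  by (induction n) auto

lemma fps_nonneg_sum_list: "(\<And>A. A \<in> set As \<Longrightarrow> fps_nonneg A) \<Longrightarrow> fps_nonneg (sum_list As)"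
  by (induction As) auto

lemma fps_nonneg_deriv: "fps_nonneg A \<Longrightarrow> fps_nonneg (fps_deriv A)"
  by (auto simp: fps_nonneg_def)

text \<open>The inverse \<open>I\<close> satisfies \<open>I = 1 + E * I\<close>; as \<open>E\<close>
  has no constant term, every coefficient of \<open>I\<close> is determined nonnegatively by earlier
  ones.\<close>

lemma fps_nonneg_inverse_one_minus:
  assumes "fps_nonneg E" "fps_nth E 0 = 0"
  shows "fps_nonneg (inverse (1 - E))"
proof -
  define I where "I = inverse (1 - E)"
  have "I * (1 - E) = 1"
    unfolding I_def by (rule inverse_mult_eq_1) (use assms in simp)
  hence I: "I = 1 + E * I" by (simp add: algebra_simps)
  have "0 \<le> fps_nth I n" for n
  proof (induction n rule: less_induct)
    case (less n)
    have "fps_nth I n = fps_nth 1 n + (\<Sum>i=0..n. fps_nth E i * fps_nth I (n - i))"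
      by (subst I) (simp add: fps_mult_nth)
    moreover have "0 \<le> fps_nth E i * fps_nth I (n - i)" if "i \<in> {0..n}" for i
      using less[of "n - i"] assms that
      by (cases "i = 0") (auto simp: fps_nonneg_def intro!: mult_nonneg_nonneg)
    hence "0 \<le> (\<Sum>i=0..n. fps_nth E i * fps_nth I (n - i))" by (rule sum_nonneg)
    ultimately show ?case by simp
  qed
  thus ?thesis by (simp add: fps_nonneg_def I_def)
qed

definition fps_le :: "real fps \<Rightarrow> real fps \<Rightarrow> bool" where
  "fps_le A B \<longleftrightarrow> fps_nonneg (B - A)"

lemma fps_le_iff: "fps_le A B \<longleftrightarrow> (\<forall>n. fps_nth A n \<le> fps_nth B n)"
  by (simp add: fps_le_def fps_nonneg_def)

lemma fps_le_refl [simp]: "fps_le A A"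
  by (simp add: fps_le_iff)

lemma fps_le_trans: "fps_le A B \<Longrightarrow> fps_le B C \<Longrightarrow> fps_le A C"
  by (meson fps_le_iff order_trans)

lemma fps_le_antisym: "fps_le A B \<Longrightarrow> fps_le B A \<Longrightarrow> A = B"
  by (auto simp: fps_le_iff fps_eq_iff intro: antisym)

definition fps_lt :: "real fps \<Rightarrow> real fps \<Rightarrow> bool" where
  "fps_lt A B \<longleftrightarrow> fps_le A B \<and> A \<noteq> B"

lemma fps_lt_le_trans: "fps_lt A B \<Longrightarrow> fps_le B C \<Longrightarrow> fps_lt A C"
  unfolding fps_lt_def by (metis fps_le_antisym fps_le_trans)

lemma fps_le_lt_trans: "fps_le A B \<Longrightarrow> fps_lt B C \<Longrightarrow> fps_lt A C"
  unfolding fps_lt_def by (metis fps_le_antisym fps_le_trans)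

text \<open>For \<open>P = det (1 - X A)\<close> this is the series of the traces of
  \<open>A^k\<close> over k \<ge> 1.\<close>

definition neg_logderiv :: "real fps \<Rightarrow> real fps" where
  "neg_logderiv P = - (fps_X * fps_deriv P * inverse P)"

lemma neg_logderiv_mult:
  assumes "fps_nth P 0 = 1" "fps_nth Q 0 = 1"
  shows "neg_logderiv (P * Q) = neg_logderiv P + neg_logderiv Q"
proof -
  have P: "inverse P * P = 1" and Q: "inverse Q * Q = 1"
    using assms by (auto intro: inverse_mult_eq_1)
  have "neg_logderiv (P * Q)
      = - (fps_X * fps_deriv P * inverse P * (inverse Q * Q))
        - (fps_X * fps_deriv Q * inverse Q * (inverse P * P))"
    using assms by (simp add: neg_logderiv_def fps_inverse_mult algebra_simps)
  thus ?thesis unfolding P Q by (simp add: neg_logderiv_def)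
qed

lemma neg_logderiv_inverse:
  assumes "fps_nth P 0 = 1"
  shows "neg_logderiv (inverse P) = - neg_logderiv P"
proof -
  have "neg_logderiv P + neg_logderiv (inverse P) = neg_logderiv (P * inverse P)"
    using assms by (simp add: neg_logderiv_mult)
  also have "P * inverse P = 1"
    using assms inverse_mult_eq_1[of P] by (simp add: mult.commute)
  finally show ?thesis by (simp add: neg_logderiv_def add_eq_0_iff)
qed

text \<open>The factor \<open>1 - E\<close> contributes \<open>X E' / (1 - E)\<close>, a product of
  nonnegative series; it vanishes only if \<open>E\<close> is constant, hence
  \<open>0\<close>.\<close>

lemma neg_logderiv_mono:
  assumes "Q = P * (1 - E)" "fps_nth P 0 = 1" "fps_nth E 0 = 0" "fps_nonneg E"
  shows "fps_le (neg_logderiv P) (neg_logderiv Q)"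
    and "E \<noteq> 0 \<Longrightarrow> fps_lt (neg_logderiv P) (neg_logderiv Q)"
proof -
  have *: "neg_logderiv Q - neg_logderiv P = fps_X * fps_deriv E * inverse (1 - E)"
    using assms by (simp add: neg_logderiv_mult) (simp add: neg_logderiv_def)
  have "fps_nonneg (fps_X * fps_deriv E * inverse (1 - E))"
    using assms by (intro fps_nonneg_mult fps_nonneg_deriv fps_nonneg_inverse_one_minus) auto
  thus le: "fps_le (neg_logderiv P) (neg_logderiv Q)"
    by (simp add: fps_le_def *)
  assume "E \<noteq> 0"
  have "fps_deriv E \<noteq> 0"
  proof
    assume "fps_deriv E = 0"
    hence "E = fps_const (fps_nth E 0)" using fps_deriv_eq_0_iff by metis
    thus False using assms \<open>E \<noteq> 0\<close> by simp
  qed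
  moreover have "inverse (1 - E) \<noteq> 0" using assms by simp
  ultimately have "neg_logderiv Q - neg_logderiv P \<noteq> 0" unfolding * by simp
  thus "fps_lt (neg_logderiv P) (neg_logderiv Q)"
    using le by (auto simp: fps_lt_def)
qed

text \<open>The case \<open>E = D / P\<close>: the determinant identities below give the difference
  \<open>D\<close> explicitly, so that only the sign of \<open>D / P\<close> has to be
  checked.\<close>

lemma neg_logderiv_mono_diff:
  assumes "Q = P - D" "fps_nth P 0 = 1" "fps_nth D 0 = 0" "fps_nonneg (D * inverse P)"
  shows "fps_le (neg_logderiv P) (neg_logderiv Q)"
    and "D \<noteq> 0 \<Longrightarrow> fps_lt (neg_logderiv P) (neg_logderiv Q)"
proof -
  have P: "P * inverse P = 1"
    using assms inverse_mult_eq_1[of P] by (simp add: mult.commute)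
  have Q: "Q = P * (1 - D * inverse P)"
    using assms(1) P by (simp add: algebra_simps)
  show "fps_le (neg_logderiv P) (neg_logderiv Q)"
    by (rule neg_logderiv_mono(1)[OF Q]) (use assms in auto)
  assume "D \<noteq> 0"
  moreover have "inverse P \<noteq> 0" using assms by simp
  ultimately show "fps_lt (neg_logderiv P) (neg_logderiv Q)"
    by (intro neg_logderiv_mono(2)[OF Q]) (use assms in auto)
qed

section \<open>Determinants of paths\<close>

text \<open>\<open>det (1 - X A)\<close> for the adjacency matrix \<open>A\<close> of the path on \<open>n\<close> vertices.\<close>

fun path_det :: "nat \<Rightarrow> real fps" where
  "path_det 0 = 1"
| "path_det (Suc 0) = 1"
| "path_det (Suc (Suc n)) = path_det (Suc n) - fps_X ^ 2 * path_det n"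

text \<open>The generating function of the closed walks at an end vertex of the path; the value at
  \<open>0\<close> lets empty branches drop out of all sums.\<close>

definition path_end :: "nat \<Rightarrow> real fps" where
  "path_end n = (case n of 0 \<Rightarrow> 0 | Suc m \<Rightarrow> path_det m * inverse (path_det (Suc m)))"

lemma path_det_nth_0 [simp]: "fps_nth (path_det n) 0 = 1"
  by (induction n rule: path_det.induct) auto

lemma path_det_mult_inverse [simp]: "path_det n * inverse (path_det n) = 1" "inverse (path_det n) * path_det n = 1"
  using inverse_mult_eq_1[of "path_det n"] by (auto simp: mult.commute)

lemma path_det_nonzero [simp]: "path_det n \<noteq> 0"
  using path_det_mult_inverse(1)[of n] by (metis mult_zero_left zero_neq_one)

lemma path_end_0 [simp]: "path_end 0 = 0"
  by (simp add: path_end_def)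

lemma path_end_Suc: "path_end (Suc n) = path_det n * inverse (path_det (Suc n))"
  by (simp add: path_end_def)

lemma path_det_Suc_mult_path_end: "path_det (Suc n) * path_end (Suc n) = path_det n"
  by (simp add: path_end_Suc ac_simps)

lemma path_det_Suc: "path_det (Suc n) = path_det n * (1 - fps_X ^ 2 * path_end n)"
proof (cases n)
  case (Suc m)
  have "path_det n * (1 - fps_X ^ 2 * path_end n) = path_det n - fps_X ^ 2 * (path_det n * path_end n)"
    by (simp add: algebra_simps)
  also have "path_det n * path_end n = path_det m" using Suc path_det_Suc_mult_path_end by simp
  finally show ?thesis using Suc by simp
qed simp

text \<open>Continued fraction of the path: a closed walk at the end vertex is a sequence of
  excursions, each crossing the first edge twice around a closed walk at the end of the shortened
  path.\<close>

lemma path_end_Suc_mult: "path_end (Suc n) * (1 - fps_X ^ 2 * path_end n) = 1"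
proof -
  have "path_det n * (path_end (Suc n) * (1 - fps_X ^ 2 * path_end n)) = path_det n * 1"
    using path_det_Suc_mult_path_end[of n] path_det_Suc[of n] by (simp add: ac_simps)
  thus ?thesis by (metis mult_left_cancel path_det_nonzero)
qed

lemma path_end_Suc_eq_inverse: "path_end (Suc n) = inverse (1 - fps_X ^ 2 * path_end n)"
  using path_end_Suc_mult[of n] fps_inverse_unique[of "1 - fps_X ^ 2 * path_end n" "path_end (Suc n)"]
  by (simp add: mult.commute)

lemma path_end_nonneg [simp, intro]: "fps_nonneg (path_end n)"
proof (induction n)
  case (Suc n)
  show ?case unfolding path_end_Suc_eq_inverse
    by (rule fps_nonneg_inverse_one_minus) (use Suc in auto)
qed simp

text \<open>Subtracting two consecutive instances of the continued fraction; the increments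
  propagate with a nonnegative factor.\<close>

lemma path_end_Suc_Suc_diff:
  "path_end (Suc (Suc n)) - path_end (Suc n) = fps_X ^ 2 * (path_end (Suc n) - path_end n) * path_end (Suc n) * path_end (Suc (Suc n))"
proof -
  let ?Z = "fps_X ^ 2 :: real fps"
  have 1: "path_end (Suc n) * (1 - ?Z * path_end n) = 1" by (rule path_end_Suc_mult)
  have 2: "path_end (Suc (Suc n)) * (1 - ?Z * path_end (Suc n)) = 1" by (rule path_end_Suc_mult)
  show ?thesis using 1 2 by algebra
qed

lemma path_end_Suc_diff: "fps_nonneg (path_end (Suc n) - path_end n) \<and> path_end (Suc n) \<noteq> path_end n"
proof (induction n)
  case 0
  show ?case by (simp add: path_end_Suc)
next
  case (Suc n)
  have "fps_nonneg (path_end (Suc (Suc n)) - path_end (Suc n))"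
    unfolding path_end_Suc_Suc_diff using Suc by (intro fps_nonneg_mult) auto
  moreover have "path_end (Suc k) \<noteq> 0" for k
    using path_det_Suc_mult_path_end[of k] by (metis mult_zero_right path_det_nonzero)
  hence "path_end (Suc (Suc n)) - path_end (Suc n) \<noteq> 0"
    unfolding path_end_Suc_Suc_diff using Suc by simp
  ultimately show ?case by simp
qed

lemma path_end_mono: "m \<le> n \<Longrightarrow> fps_nonneg (path_end n - path_end m)"
proof (induction n rule: dec_induct)
  case (step n)
  thus ?case using fps_nonneg_add[of "path_end (Suc n) - path_end n" "path_end n - path_end m"] path_end_Suc_diff by simp
qed simp

text \<open>Equality would squeeze \<open>path_end (Suc m)\<close> between two equal series,
  although consecutive values differ.\<close>

lemma path_end_strict_mono: "m < n \<Longrightarrow> path_end m \<noteq> path_end n"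
proof
  assume "m < n" "path_end m = path_end n"
  moreover from this have "fps_nonneg (path_end n - path_end (Suc m))" by (intro path_end_mono) simp
  moreover have "fps_nonneg (path_end (Suc m) - path_end m)" "path_end (Suc m) \<noteq> path_end m"
    using path_end_Suc_diff by auto
  ultimately show False
    using fps_le_antisym[of "path_end (Suc m)" "path_end m"] by (simp add: fps_le_def)
qed

text \<open>The ratio telescopes into the product of \<open>path_end i\<close> over m < i \<le>
  n.\<close>

lemma path_det_ratio_nonneg: "m \<le> n \<Longrightarrow> fps_nonneg (path_det m * inverse (path_det n))"
proof (induction n rule: dec_induct)
  case (step n)
  have "path_det m * inverse (path_det (Suc n)) = path_det m * inverse (path_det n) * path_end (Suc n)"
    by (simp add: path_end_Suc)
  thus ?case using fps_nonneg_mult[OF step.IH path_end_nonneg[of "Suc n"]] by (simp only:)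
qed simp

lemma inverse_one_minus_X2_nonneg:
  "fps_nonneg A \<Longrightarrow> fps_nonneg (inverse (1 - fps_X ^ 2 * A))"
  by (rule fps_nonneg_inverse_one_minus) auto

text \<open>For \<open>A = path_end p * C\<close> and \<open>B = r * path_end p\<close> these are the interpolating determinants.
  As functions of \<open>q\<close> they satisfy the recurrence of \<open>path_det\<close>.\<close>

definition weighted_det :: "real fps \<Rightarrow> real fps \<Rightarrow> nat \<Rightarrow> real fps" where
  "weighted_det A B q = path_det q * (1 - fps_X ^ 2 * (A + B * path_end q))"

lemma weighted_det_Suc: "weighted_det A B (Suc q) = (1 - fps_X ^ 2 * A) * path_det (Suc q) - fps_X ^ 2 * B * path_det q"
proof -
  have "weighted_det A B (Suc q) = (1 - fps_X ^ 2 * A) * path_det (Suc q) - fps_X ^ 2 * B * (path_det (Suc q) * path_end (Suc q))"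
    unfolding weighted_det_def by (simp only: algebra_simps)
  thus ?thesis by (simp only: path_det_Suc_mult_path_end)
qed

lemma weighted_det_rec: "weighted_det A B (Suc (Suc q)) = weighted_det A B (Suc q) - fps_X ^ 2 * weighted_det A B q"
proof (cases q)
  case 0
  thus ?thesis unfolding weighted_det_Suc 0 by (simp add: weighted_det_def algebra_simps)
next
  case (Suc m)
  thus ?thesis by (simp add: weighted_det_Suc algebra_simps)
qed

text \<open>Both sides obey the recurrence of \<open>path_det\<close> in \<open>d\<close>, so two
  initial cases suffice. For plain paths this is the expansion along a cut edge.\<close>

lemma weighted_det_add:
  "weighted_det A B (Suc (m + Suc d)) = weighted_det A B (Suc m) * path_det (Suc d) - fps_X ^ 2 * weighted_det A B m * path_det d"
proof (induction d rule: path_det.induct)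
  case 1
  show ?case by (simp add: weighted_det_rec)
next
  case 2
  show ?case by (simp add: weighted_det_rec algebra_simps)
next
  case (3 d)
  have "weighted_det A B (Suc (m + Suc (Suc (Suc d)))) = weighted_det A B (Suc (m + Suc (Suc d))) - fps_X ^ 2 * weighted_det A B (Suc (m + Suc d))"
    by (simp add: weighted_det_rec)
  thus ?case unfolding 3 by (simp add: algebra_simps)
qed

lemma path_det_add: "path_det (Suc (m + Suc d)) = path_det (Suc m) * path_det (Suc d) - fps_X ^ 2 * path_det m * path_det d"
  using weighted_det_add[of 0 0 m d] by (simp add: weighted_det_def)

text \<open>A Casorati determinant of two solutions of one second-order recurrence: shifting both
  indices by one multiplies it by \<open>X^2\<close>.\<close>

lemma weighted_det_casorati:
  "weighted_det A B (m + Suc x) * path_det (Suc x) - weighted_det A B (Suc (m + Suc x)) * path_det x = (fps_X ^ 2) ^ Suc x * weighted_det A B m"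
proof (induction x)
  case 0
  show ?case by (simp add: weighted_det_rec)
next
  case (Suc x)
  have "weighted_det A B (m + Suc (Suc x)) * path_det (Suc (Suc x)) - weighted_det A B (Suc (m + Suc (Suc x))) * path_det (Suc x)
    = fps_X ^ 2 * (weighted_det A B (m + Suc x) * path_det (Suc x) - weighted_det A B (Suc (m + Suc x)) * path_det x)"
    by (simp add: weighted_det_rec algebra_simps)
  thus ?case unfolding Suc by (simp add: ac_simps)
qed

text \<open>After expansion by the two addition formulas the leading products cancel and a Casorati
  determinant remains. The surplus \<open>Suc d\<close> moves from the plain path to the weighted
  one.\<close>

lemma weighted_det_exchange:
  "weighted_det A B (Suc (m + Suc x)) * path_det (Suc (x + Suc d)) - weighted_det A B (Suc (m + Suc x + Suc d)) * path_det (Suc x)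
   = (fps_X ^ 2) ^ Suc (Suc x) * (path_det d * weighted_det A B m)"
proof -
  have "weighted_det A B (Suc (m + Suc x)) * path_det (Suc (x + Suc d)) - weighted_det A B (Suc (m + Suc x + Suc d)) * path_det (Suc x)
    = fps_X ^ 2 * path_det d * (weighted_det A B (m + Suc x) * path_det (Suc x) - weighted_det A B (Suc (m + Suc x)) * path_det x)"
    unfolding path_det_add weighted_det_add by (simp add: algebra_simps)
  thus ?thesis unfolding weighted_det_casorati by (simp add: ac_simps)
qed

section \<open>Exchanging branches\<close>

lemma neg_logderiv_mono_factor:
  assumes "fps_nth K 0 = 1" "fps_nth P 0 = 1" "fps_nth Q 0 = 1"
  shows "fps_le (neg_logderiv (K * P)) (neg_logderiv (K * Q)) \<longleftrightarrow> fps_le (neg_logderiv P) (neg_logderiv Q)"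
    and "fps_lt (neg_logderiv (K * P)) (neg_logderiv (K * Q)) \<longleftrightarrow> fps_lt (neg_logderiv P) (neg_logderiv Q)"
  using assms by (auto simp: neg_logderiv_mult fps_lt_def fps_le_def)

text \<open>Covers the moves that keep the product of path determinants and only raise the series in
  the remaining factor.\<close>

lemma neg_logderiv_one_minus_mono:
  assumes "fps_nonneg A" "fps_nonneg (B - A)"
  shows "fps_le (neg_logderiv (1 - fps_X ^ 2 * A)) (neg_logderiv (1 - fps_X ^ 2 * B))"
    and "A \<noteq> B \<Longrightarrow> fps_lt (neg_logderiv (1 - fps_X ^ 2 * A)) (neg_logderiv (1 - fps_X ^ 2 * B))"
proof -
  have *: "1 - fps_X ^ 2 * B = (1 - fps_X ^ 2 * A) - fps_X ^ 2 * (B - A)"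
    by (simp add: algebra_simps)
  have **: "fps_nonneg (fps_X ^ 2 * (B - A) * inverse (1 - fps_X ^ 2 * A))"
    by (intro fps_nonneg_mult inverse_one_minus_X2_nonneg) (use assms in auto)
  show "fps_le (neg_logderiv (1 - fps_X ^ 2 * A)) (neg_logderiv (1 - fps_X ^ 2 * B))"
    by (rule neg_logderiv_mono_diff(1)[OF *]) (use ** in auto)
  show "fps_lt (neg_logderiv (1 - fps_X ^ 2 * A)) (neg_logderiv (1 - fps_X ^ 2 * B))" if "A \<noteq> B"
    by (rule neg_logderiv_mono_diff(2)[OF *]) (use ** that in auto)
qed

lemma weighted_det_nth_0 [simp]: "fps_nth (weighted_det A B q) 0 = 1"
  by (simp add: weighted_det_def)

text \<open>The path factors have a nonnegative ratio. In the other factor, going back from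
  \<open>q\<close> to \<open>m\<close> adds a nonnegative multiple of
  \<open>path_end q - path_end m\<close>, so its quotient is 1 plus a nonnegative series.\<close>

lemma weighted_det_ratio_nonneg:
  assumes "fps_nonneg A" "fps_nonneg B" "m \<le> q"
  shows "fps_nonneg (weighted_det A B m * inverse (weighted_det A B q))"
proof -
  let ?b = "1 - fps_X ^ 2 * (A + B * path_end q)"
  have b: "?b * inverse ?b = 1"
    using inverse_mult_eq_1[of ?b] by (simp add: mult.commute)
  have "weighted_det A B m * inverse (weighted_det A B q)
      = path_det m * inverse (path_det q) * ((1 - fps_X ^ 2 * (A + B * path_end m)) * inverse ?b)"
    by (simp add: weighted_det_def fps_inverse_mult ac_simps)
  also have "(1 - fps_X ^ 2 * (A + B * path_end m)) = ?b + fps_X ^ 2 * (B * (path_end q - path_end m))"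
    by (simp add: algebra_simps)
  also have "\<dots> * inverse ?b = 1 + fps_X ^ 2 * (B * (path_end q - path_end m)) * inverse ?b"
    unfolding distrib_right b ..
  finally show ?thesis
    using assms by (simp only:)
      (intro fps_nonneg_mult fps_nonneg_add path_det_ratio_nonneg inverse_one_minus_X2_nonneg path_end_mono, auto)
qed

text \<open>If \<open>y = Suc x\<close>, nothing changes. Otherwise the exchange identity gives
  \<open>Q = P - ?D\<close>, and \<open>?D / P\<close> is a power of \<open>X\<close> times two
  nonnegative determinant ratios.\<close>

lemma weighted_det_exchange_le:
  assumes "fps_nonneg A" "fps_nonneg B" "x < y" "y \<le> q"
  defines "P \<equiv> path_det y * weighted_det A B q" and "Q \<equiv> path_det (Suc x) * weighted_det A B (q + (y - Suc x))"
  shows "fps_le (neg_logderiv P) (neg_logderiv Q)"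
    and "Suc x < y \<Longrightarrow> fps_lt (neg_logderiv P) (neg_logderiv Q)"
proof -
  have "fps_lt (neg_logderiv P) (neg_logderiv Q)" if y: "Suc x < y"
  proof -
    obtain d where d: "y = Suc (x + Suc d)"
      using less_imp_Suc_add[OF y] by auto
    \<comment> \<open>From \<open>y \<le> q\<close> and \<open>Suc x < y\<close> it follows that
      \<open>q\<close> is at least \<open>Suc (Suc x)\<close>, so the index \<open>m\<close>
      exists.\<close>
    obtain m where m: "q = Suc (m + Suc x)"
      using less_imp_Suc_add[of "Suc x" q] y assms(4) by (auto simp: add.commute)
    let ?D = "(fps_X ^ 2) ^ Suc (Suc x) * (path_det d * weighted_det A B m)"
    have q': "q + (y - Suc x) = Suc (m + Suc x + Suc d)" by (simp add: d m)
    have Q: "Q = P - ?D"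
      using weighted_det_exchange[of A B m x d] unfolding P_def Q_def q' unfolding d m
      by (simp add: algebra_simps del: path_det.simps)
    have "?D * inverse P = (fps_X ^ 2) ^ Suc (Suc x)
        * (path_det d * inverse (path_det y)) * (weighted_det A B m * inverse (weighted_det A B q))"
      unfolding P_def fps_inverse_mult by (simp only: ac_simps)
    also have "fps_nonneg \<dots>"
      by (intro fps_nonneg_mult fps_nonneg_power path_det_ratio_nonneg weighted_det_ratio_nonneg)
         (use assms d m in auto)
    finally have nonneg: "fps_nonneg (?D * inverse P)" .
    have "weighted_det A B m \<noteq> 0" by (metis fps_zero_nth weighted_det_nth_0 zero_neq_one)
    hence "?D \<noteq> 0" by simp
    thus ?thesis
      by (intro neg_logderiv_mono_diff(2)[OF Q _ _ nonneg]) (auto simp: P_def)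
  qed
  moreover have "P = Q" if "y = Suc x" using that by (simp add: P_def Q_def)
  ultimately show "fps_le (neg_logderiv P) (neg_logderiv Q)"
    and "Suc x < y \<Longrightarrow> fps_lt (neg_logderiv P) (neg_logderiv Q)"
    using assms(3) by (cases "y = Suc x"; auto simp: fps_lt_def)+
qed

text \<open>Two moves with \<open>?R\<close> in between: the series of branch \<open>y\<close> is
  replaced by that of \<open>q\<close>, whose weight grows from \<open>j\<close> to
  \<open>Suc j\<close>; then the surplus of \<open>y\<close> over \<open>Suc x\<close> goes to
  \<open>q\<close>. The factor \<open>path_end (Suc x)\<close> arises from joining the center to a
  branch of length \<open>x\<close>, see \<open>star_det_merge_branch\<close>.\<close>

lemma absorb_branch:
  fixes j x y q :: nat
  assumes "fps_nonneg C" "x < y" "y \<le> q"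
  defines "P \<equiv> path_det y * (path_det q * (1 - fps_X ^ 2 * (path_end (Suc x) * (C + path_end y + of_nat j * path_end q))))"
    and "Q \<equiv> path_det (Suc x) * weighted_det (path_end (Suc x) * C) (of_nat (Suc j) * path_end (Suc x)) (q + (y - Suc x))"
  shows "fps_le (neg_logderiv P) (neg_logderiv Q)"
    and "Suc x < q \<Longrightarrow> fps_lt (neg_logderiv P) (neg_logderiv Q)"
proof -
  let ?A = "path_end (Suc x) * C" and ?B = "of_nat (Suc j) * path_end (Suc x)"
  let ?R = "path_det y * weighted_det ?A ?B q"
  let ?a = "path_end (Suc x) * (C + path_end y + of_nat j * path_end q)"
  have A: "fps_nonneg ?A" and B: "fps_nonneg ?B" and a: "fps_nonneg ?a"
    using assms by (auto intro!: fps_nonneg_mult fps_nonneg_add simp del: of_nat_Suc)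
  have P: "P = path_det y * path_det q * (1 - fps_X ^ 2 * ?a)" by (simp add: P_def mult.assoc)
  have R: "?R = path_det y * path_det q * (1 - fps_X ^ 2 * (?A + ?B * path_end q))"
    by (simp add: weighted_det_def mult.assoc)
  have d: "?A + ?B * path_end q - ?a = path_end (Suc x) * (path_end q - path_end y)"
    by (simp add: algebra_simps)
  have nn: "fps_nonneg (?A + ?B * path_end q - ?a)"
    unfolding d using path_end_mono[OF assms(3)] by auto
  have PR: "fps_le (neg_logderiv P) (neg_logderiv ?R)"
    unfolding P R by (subst neg_logderiv_mono_factor)
      (use neg_logderiv_one_minus_mono(1)[OF a nn] in auto)
  have PR': "fps_lt (neg_logderiv P) (neg_logderiv ?R)" if "y < q"
  proof -
    have "path_end (Suc x) \<noteq> 0" using path_end_strict_mono[of 0 "Suc x"] by auto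
    hence "?A + ?B * path_end q - ?a \<noteq> 0"
      unfolding d using path_end_strict_mono[OF that] by auto
    hence ne: "?a \<noteq> ?A + ?B * path_end q" by auto
    show ?thesis using neg_logderiv_one_minus_mono(2)[OF a nn ne]
      unfolding P R by (subst neg_logderiv_mono_factor) auto
  qed
  note RQ = weighted_det_exchange_le[OF A B assms(2,3), folded Q_def]
  show "fps_le (neg_logderiv P) (neg_logderiv Q)"
    using fps_le_trans[OF PR RQ(1)] .
  show "fps_lt (neg_logderiv P) (neg_logderiv Q)" if "Suc x < q"
  \<comment> \<open>If \<open>y < q\<close>, the first move is strict; if \<open>y = q\<close>, then
    \<open>y\<close> exceeds \<open>Suc x\<close> and the second one is.\<close>
  proof (cases "y < q")
    case True
    show ?thesis using fps_lt_le_trans[OF PR'[OF True] RQ(1)] .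
  next
    case False
    hence xy: "Suc x < y" using that assms by simp
    show ?thesis using fps_le_lt_trans[OF PR RQ(2)[OF xy]] .
  qed
qed

lemma prod_list_path_det_nth_0 [simp]: "fps_nth (prod_list (map path_det as)) 0 = 1"
  by (induction as) auto

lemma path_det_power_nth_0 [simp]: "fps_nth (path_det n ^ k) 0 = 1"
  by (induction k) auto

lemma sum_list_path_end_nonneg [simp, intro]: "fps_nonneg (sum_list (map path_end as))"
  by (rule fps_nonneg_sum_list) auto

text \<open>The branches are absorbed one at a time; \<open>j\<close> is the weight collected so
  far, and \<open>q\<close> only grows, so it keeps bounding the remaining branches. The first
  absorption already yields strictness.\<close>

lemma absorb_branches:
  fixes j x q :: nat and ys :: "nat list"
  assumes "fps_nonneg C" "\<forall>y\<in>set ys. x < y \<and> y \<le> q"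
  defines "P \<equiv> prod_list (map path_det ys) *
      (path_det q * (1 - fps_X ^ 2 * (path_end (Suc x) * (C + sum_list (map path_end ys) + of_nat j * path_end q))))"
    and "Q \<equiv> path_det (Suc x) ^ length ys * weighted_det (path_end (Suc x) * C) (of_nat (j + length ys) * path_end (Suc x))
      (q + sum_list (map (\<lambda>y. y - Suc x) ys))"
  shows "fps_le (neg_logderiv P) (neg_logderiv Q)"
    and "ys \<noteq> [] \<Longrightarrow> Suc x < q \<Longrightarrow> fps_lt (neg_logderiv P) (neg_logderiv Q)"
proof -
  let ?P = "\<lambda>ys j q. prod_list (map path_det ys) *
      (path_det q * (1 - fps_X ^ 2 * (path_end (Suc x) * (C + sum_list (map path_end ys) + of_nat j * path_end q))))"
  let ?Q = "\<lambda>ys j q. path_det (Suc x) ^ length ys *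
      weighted_det (path_end (Suc x) * C) (of_nat (j + length ys) * path_end (Suc x)) (q + sum_list (map (\<lambda>y. y - Suc x) ys))"
  have "fps_le (neg_logderiv (?P ys j q)) (neg_logderiv (?Q ys j q)) \<and>
    (ys \<noteq> [] \<longrightarrow> Suc x < q \<longrightarrow> fps_lt (neg_logderiv (?P ys j q)) (neg_logderiv (?Q ys j q)))"
    using assms(2)
  proof (induction ys arbitrary: j q)
    case Nil
    have "?P [] j q = ?Q [] j q" by (simp add: weighted_det_def algebra_simps)
    thus ?case by simp
  next
    case (Cons y ys)
    define C' where "C' = C + sum_list (map path_end ys)"
    define q' where "q' = q + (y - Suc x)"
    let ?K = "prod_list (map path_det ys)"
    let ?P1 = "path_det y * (path_det q * (1 - fps_X ^ 2 * (path_end (Suc x) * (C' + path_end y + of_nat j * path_end q))))"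
    let ?Q1 = "path_det (Suc x) * weighted_det (path_end (Suc x) * C') (of_nat (Suc j) * path_end (Suc x)) q'"
    have C': "fps_nonneg C'" using assms(1) by (auto simp: C'_def)
    have P: "?P (y # ys) j q = ?K * ?P1" by (simp add: C'_def ac_simps)
    \<comment> \<open>The determinant after one absorption has the initial shape again, with
      \<open>Suc j\<close> and \<open>q'\<close>, up to a factor
      \<open>path_det (Suc x)\<close>.\<close>
    have Q1: "?K * ?Q1 = path_det (Suc x) * ?P ys (Suc j) q'"
      by (simp add: weighted_det_def C'_def algebra_simps)
    have Q: "?Q (y # ys) j q = path_det (Suc x) * ?Q ys (Suc j) q'"
      by (simp add: q'_def ac_simps)
    have xy: "x < y" "y \<le> q" using Cons.prems by auto
    have "\<forall>y\<in>set ys. x < y \<and> y \<le> q'" using Cons.prems by (auto simp: q'_def)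
    hence IH: "fps_le (neg_logderiv (?P ys (Suc j) q')) (neg_logderiv (?Q ys (Suc j) q'))"
      using Cons.IH by blast
    have le2: "fps_le (neg_logderiv (?K * ?Q1)) (neg_logderiv (?Q (y # ys) j q))"
      unfolding Q1 Q by (subst neg_logderiv_mono_factor) (use IH in auto)
    note ab = absorb_branch[OF C' xy, of j, folded q'_def]
    have le1: "fps_le (neg_logderiv (?P (y # ys) j q)) (neg_logderiv (?K * ?Q1))"
      unfolding P by (subst neg_logderiv_mono_factor) (use ab(1) in auto)
    have lt1: "fps_lt (neg_logderiv (?P (y # ys) j q)) (neg_logderiv (?K * ?Q1))" if "Suc x < q"
      unfolding P by (subst neg_logderiv_mono_factor) (use ab(2) that in auto)
    show ?case using fps_le_trans[OF le1 le2] fps_lt_le_trans[OF lt1 le2] by blast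
  qed
  thus "fps_le (neg_logderiv P) (neg_logderiv Q)"
    and "ys \<noteq> [] \<Longrightarrow> Suc x < q \<Longrightarrow> fps_lt (neg_logderiv P) (neg_logderiv Q)"
    by (simp_all add: P_def Q_def)
qed

section \<open>Determinants of starlike trees and the elementary step\<close>

definition star_det :: "nat list \<Rightarrow> real fps" where
  "star_det as = prod_list (map path_det as) * (1 - fps_X ^ 2 * sum_list (map path_end as))"

text \<open>The center and a branch of length \<open>x\<close> form a path on \<open>Suc x\<close>
  vertices; the other branches, collected in \<open>C\<close>, hang on its end vertex.\<close>

lemma star_det_merge_branch:
  fixes C :: "real fps"
  shows "path_det x * (1 - fps_X ^ 2 * (path_end x + C)) = path_det (Suc x) * (1 - fps_X ^ 2 * (path_end (Suc x) * C))"
proof -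
  have "path_det (Suc x) * (1 - fps_X ^ 2 * (path_end (Suc x) * C))
      = path_det (Suc x) - fps_X ^ 2 * C * (path_det (Suc x) * path_end (Suc x))"
    by (simp add: algebra_simps del: path_det.simps)
  also have "\<dots> = path_det x * (1 - fps_X ^ 2 * path_end x) - fps_X ^ 2 * C * path_det x"
    unfolding path_det_Suc_mult_path_end by (simp only: path_det_Suc)
  finally show ?thesis by (simp add: algebra_simps)
qed

lemma sum_list_replicate_fps: "sum_list (replicate n (c :: real fps)) = of_nat n * c"
  by (induction n) (auto simp: algebra_simps)

text \<open>The center is joined to the branch \<open>x\<close> before the step and to the branch
  \<open>z\<close> after it, hence \<open>Suc z\<close> in the length balance. Absorbing
  \<open>ys\<close> leads to \<open>?K * ?Q\<close>; then \<open>Suc x\<close> and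
  \<open>Suc z\<close> swap roles between \<open>?a\<close> and \<open>?b\<close>, with a gain
  proportional to \<open>C\<close>. So strictness can come from \<open>ys\<close> or from
  \<open>C\<close>.\<close>

lemma star_det_jump:
  fixes x q z :: nat and cs ys :: "nat list"
  assumes "\<forall>y\<in>set ys. x < y \<and> y \<le> q" "x < q"
    and "Suc z = q + sum_list (map (\<lambda>y. y - Suc x) ys)"
  defines "as \<equiv> cs @ x # ys @ [q]" and "bs \<equiv> cs @ replicate (Suc (length ys)) (Suc x) @ [z]"
  shows "fps_le (neg_logderiv (star_det as)) (neg_logderiv (star_det bs))"
    and "Suc x < q \<Longrightarrow> ys \<noteq> [] \<or> sum_list (map path_end cs) \<noteq> 0 \<Longrightarrow>
      fps_lt (neg_logderiv (star_det as)) (neg_logderiv (star_det bs))"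
proof -
  define C where "C = sum_list (map path_end cs)"
  have C: "fps_nonneg C" by (auto simp: C_def)
  define r where "r = Suc (length ys)"
  let ?K = "prod_list (map path_det cs) * path_det (Suc x)"
  let ?P = "prod_list (map path_det ys) *
      (path_det q * (1 - fps_X ^ 2 * (path_end (Suc x) * (C + sum_list (map path_end ys) + of_nat 1 * path_end q))))"
  let ?Q = "path_det (Suc x) ^ length ys * weighted_det (path_end (Suc x) * C) (of_nat (1 + length ys) * path_end (Suc x)) (Suc z)"
  let ?L = "prod_list (map path_det cs) * path_det (Suc x) ^ r * path_det (Suc z)"
  let ?a = "path_end (Suc x) * (C + of_nat r * path_end (Suc z))"
  let ?b = "path_end (Suc z) * (C + of_nat r * path_end (Suc x))"
  have "star_det as = prod_list (map path_det cs) * (prod_list (map path_det ys) * path_det q) *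
      (path_det x * (1 - fps_X ^ 2 * (path_end x + (C + sum_list (map path_end ys) + path_end q))))"
    by (simp add: star_det_def as_def C_def ac_simps)
  hence as: "star_det as = ?K * ?P"
    unfolding star_det_merge_branch by (simp add: ac_simps)
  have KQ: "?K * ?Q = ?L * (1 - fps_X ^ 2 * ?a)"
    by (simp add: weighted_det_def r_def algebra_simps)
  have "star_det bs = prod_list (map path_det cs) * path_det (Suc x) ^ r *
      (path_det z * (1 - fps_X ^ 2 * (path_end z + (C + of_nat r * path_end (Suc x)))))"
    by (simp add: star_det_def bs_def C_def r_def[symmetric] sum_list_replicate_fps ac_simps
        del: replicate_Suc of_nat_Suc)
  hence bs: "star_det bs = ?L * (1 - fps_X ^ 2 * ?b)"
    unfolding star_det_merge_branch by (simp add: ac_simps)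
  note ab = absorb_branches[OF C assms(1), of 1, folded assms(3)]
  have le1: "fps_le (neg_logderiv (star_det as)) (neg_logderiv (?K * ?Q))"
    unfolding as by (subst neg_logderiv_mono_factor) (use ab(1) in auto)
  have lt1: "fps_lt (neg_logderiv (star_det as)) (neg_logderiv (?K * ?Q))" if "ys \<noteq> []" "Suc x < q"
    unfolding as by (subst neg_logderiv_mono_factor) (use ab(2) that in auto)
  have a: "fps_nonneg ?a" using C by auto
  have d: "?b - ?a = (path_end (Suc z) - path_end (Suc x)) * C" by (simp add: algebra_simps)
  have nn: "fps_nonneg (?b - ?a)"
    unfolding d using C assms(2,3) by (intro fps_nonneg_mult path_end_mono) auto
  have le2: "fps_le (neg_logderiv (?K * ?Q)) (neg_logderiv (star_det bs))"
    unfolding KQ bs by (subst neg_logderiv_mono_factor)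
      (use neg_logderiv_one_minus_mono(1)[OF a nn] in auto)
  have lt2: "fps_lt (neg_logderiv (?K * ?Q)) (neg_logderiv (star_det bs))" if "C \<noteq> 0" "Suc x < q"
  proof -
    have "Suc x < Suc z" using that(2) assms(3) by simp
    hence "?b - ?a \<noteq> 0" unfolding d using that(1) path_end_strict_mono[of "Suc x" "Suc z"] by auto
    hence ne: "?a \<noteq> ?b" by auto
    show ?thesis unfolding KQ bs by (subst neg_logderiv_mono_factor)
      (use neg_logderiv_one_minus_mono(2)[OF a nn ne] in auto)
  qed
  show "fps_le (neg_logderiv (star_det as)) (neg_logderiv (star_det bs))"
    using fps_le_trans[OF le1 le2] .
  show "Suc x < q \<Longrightarrow> ys \<noteq> [] \<or> sum_list (map path_end cs) \<noteq> 0 \<Longrightarrow>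
      fps_lt (neg_logderiv (star_det as)) (neg_logderiv (star_det bs))"
    using fps_lt_le_trans[OF lt1 le2] fps_le_lt_trans[OF le1 lt2] by (auto simp: C_def)
qed

section \<open>Lexicographic chains\<close>

text \<open>Keeps the elementary step from overshooting its target. A head equal to \<open>p\<close>
  is stripped off; a larger head decides the comparison at once.\<close>

lemma replicate_lex_minimal:
  fixes ds :: "nat list"
  assumes "length ds = Suc r" "\<forall>d\<in>set ds. p \<le> d" "sum_list ds = r * p + m"
  shows "replicate r p @ [m] = ds \<or> (replicate r p @ [m], ds) \<in> lex less_than"
  using assms
proof (induction r arbitrary: ds)
  case 0
  thus ?case by (cases ds) auto
next
  case (Suc r)
  then obtain d ds' where ds: "ds = d # ds'" "length ds' = Suc r" by (cases ds) auto
  show ?case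
  proof (cases "d = p")
    case True
    have "replicate r p @ [m] = ds' \<or> (replicate r p @ [m], ds') \<in> lex less_than"
      by (rule Suc.IH) (use Suc.prems ds True in auto)
    thus ?thesis using ds True by auto
  next
    case False
    thus ?thesis using Suc.prems ds by auto
  qed
qed

lemma sum_list_diff_le:
  fixes ys :: "nat list"
  shows "\<forall>y\<in>set ys. p \<le> y \<Longrightarrow> sum_list (map (\<lambda>y. y - p) ys) + length ys * p = sum_list ys"
  by (induction ys) auto

lemma length_mult_le_sum_list:
  fixes ys :: "nat list"
  shows "\<forall>y\<in>set ys. p \<le> y \<Longrightarrow> length ys * p \<le> sum_list ys"
  by (induction ys) auto

text \<open>Serves to show that the sum is nonzero once some branch is nonempty.\<close>

lemma sum_list_path_end_nth_0: "fps_nth (sum_list (map path_end as)) 0 = real (length (filter (\<lambda>a. 0 < a) as))"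
proof (induction as)
  case (Cons a as)
  have "fps_nth (path_end a) 0 = (if 0 < a then 1 else 0)"
    by (cases a) (auto simp: path_end_Suc)
  thus ?case using Cons by simp
qed simp

text \<open>A greedy step: at the first difference with \<open>bs\<close>, the last copy of the
  smaller entry \<open>x\<close> is raised to \<open>Suc x\<close>, all later entries but the last
  drop to \<open>Suc x\<close>, and the last one takes up the rest. This is the least possible
  increase, so \<open>bs\<close> is not passed.\<close>

lemma star_det_lex_step:
  fixes as bs :: "nat list"
  assumes "sorted as" "sorted bs" "sum_list as = sum_list bs" "(as, bs) \<in> lex less_than"
  obtains as' where "sorted as'" "length as' = length as" "sum_list as' = sum_list as"
    "(as, as') \<in> lex less_than" "as' = bs \<or> (as', bs) \<in> lex less_than"
    "fps_le (neg_logderiv (star_det as)) (neg_logderiv (star_det as'))"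
    "3 \<le> length (filter (\<lambda>a. 0 < a) as) \<Longrightarrow>
      fps_lt (neg_logderiv (star_det as)) (neg_logderiv (star_det as'))"
proof -
  obtain cs x x' A B where as: "as = cs @ x # A" and bs: "bs = cs @ x' # B"
    and len: "length A = length B" and x: "x < x'"
  proof -
    have "\<exists>cs x x' A B. as = cs @ x # A \<and> bs = cs @ x' # B \<and> (x, x') \<in> less_than"
      and len: "length as = length bs"
      using assms(4) unfolding lex_conv by blast+
    then obtain cs x x' A B where "as = cs @ x # A" "bs = cs @ x' # B" "(x, x') \<in> less_than"
      by blast
    with len show thesis by (intro that[of cs x A x' B]) auto
  qed
  \<comment> \<open>Raising only the last copy of \<open>x\<close> keeps the list sorted;
    \<open>Y\<close> is what follows that copy.\<close>
  define Y where "Y = dropWhile (\<lambda>a. a = x) A"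
  define j where "j = length (takeWhile (\<lambda>a. a = x) A)"
  have "takeWhile (\<lambda>a. a = x) A = replicate j x"
    unfolding j_def by (rule replicate_length_same[symmetric]) (auto dest: set_takeWhileD)
  hence A: "A = replicate j x @ Y"
    using takeWhile_dropWhile_id[of "\<lambda>a. a = x" A] by (simp add: Y_def)
  have sortedY: "sorted Y" using assms(1) by (simp add: as A sorted_append)
  have Y: "x < y" if "y \<in> set Y" for y
  proof -
    have "Y \<noteq> []" using that by auto
    hence "hd Y \<noteq> x" unfolding Y_def by (rule hd_dropWhile)
    moreover have "x \<le> hd Y" using assms(1) \<open>Y \<noteq> []\<close> by (simp add: as A sorted_append)
    moreover have "hd Y \<le> y" using sortedY that by (cases Y) auto
    ultimately show ?thesis by simp
  qed
  have B: "\<forall>b\<in>set (x' # B). Suc x \<le> b" using assms(2) x by (auto simp: bs sorted_append)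
  have sumAB: "x + sum_list A = x' + sum_list B" using assms(3) by (simp add: as bs)
  \<comment> \<open>All of \<open>x' # B\<close> is at least \<open>Suc x\<close>, so in
    \<open>as\<close> the deficit of the \<open>Suc j\<close> copies of \<open>x\<close> must be
    made up within \<open>Y\<close>. Hence the largest entry \<open>q\<close> of \<open>Y\<close>
    exceeds \<open>Suc x\<close>.\<close>
  have sumY: "length Y * Suc x < sum_list Y"
    using length_mult_le_sum_list[OF B] sumAB len
    by (simp add: A sum_list_replicate algebra_simps flip: len)
  have "Y \<noteq> []" using sumY by auto
  define ys q where "ys = butlast Y" and "q = last Y"
  have Yq: "Y = ys @ [q]" using \<open>Y \<noteq> []\<close> by (simp add: ys_def q_def)
  have ys: "\<forall>y\<in>set ys. x < y \<and> y \<le> q" and q: "x < q"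
    using sortedY Y by (auto simp: Yq sorted_append)
  have ys': "\<forall>y\<in>set ys. Suc x \<le> y" using ys by auto
  have qx: "Suc x < q"
  proof (rule ccontr)
    assume "\<not> Suc x < q"
    hence "\<forall>y\<in>set Y. y = Suc x" using ys q by (auto simp: Yq)
    hence "replicate (length Y) (Suc x) = Y" by (intro replicate_length_same) auto
    hence "sum_list Y = length Y * Suc x" using sum_list_replicate[of "length Y" "Suc x"] by simp
    thus False using sumY by simp
  qed
  \<comment> \<open>One unit of \<open>q\<close> pays for raising \<open>x\<close>.\<close>
  define m where "m = q - 1 + sum_list (map (\<lambda>y. y - Suc x) ys)"
  have m: "Suc m = q + sum_list (map (\<lambda>y. y - Suc x) ys)" using q by (simp add: m_def)
  define cs' where "cs' = cs @ replicate j x"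
  define as' where "as' = cs' @ replicate (Suc (length ys)) (Suc x) @ [m]"
  have as2: "as = cs' @ x # ys @ [q]"
    by (simp add: as A Yq cs'_def replicate_append_same flip: append_assoc)
       (simp add: replicate_app_Cons_same)
  have sum_as': "sum_list as' = sum_list as"
    unfolding as2 as'_def using sum_list_diff_le[OF ys'] m
    by (simp add: sum_list_replicate algebra_simps)
  have "sorted as'"
    using assms(1) qx unfolding as'_def as2 m_def by (auto simp: sorted_append)
  moreover have "length as' = length as" by (simp add: as'_def as2)
  moreover note sum_as'
  moreover have "(as, as') \<in> lex less_than"
    by (simp add: as'_def as2 lex_append_leftI)
  moreover have "as' = bs \<or> (as', bs) \<in> lex less_than"
  \<comment> \<open>For \<open>j = 0\<close> the raised entry sits where \<open>as\<close> and
    \<open>bs\<close> first differ, and minimality of the new tail applies; otherwise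
    \<open>as'\<close> still has \<open>x\<close> there, below \<open>x'\<close>.\<close>
  proof (cases j)
    case 0
    have "replicate (Suc (length ys)) (Suc x) @ [m] = x' # B
        \<or> (replicate (Suc (length ys)) (Suc x) @ [m], x' # B) \<in> lex less_than"
    proof (rule replicate_lex_minimal[OF _ B])
      show "length (x' # B) = Suc (Suc (length ys))" using len A Yq 0 by simp
      show "sum_list (x' # B) = Suc (length ys) * Suc x + m"
        using sum_as' assms(3) unfolding as'_def cs'_def bs 0 by (simp add: sum_list_replicate)
    qed
    thus ?thesis by (auto simp: as'_def cs'_def 0 bs intro: lex_append_leftI)
  next
    case (Suc i)
    have "length as' = length bs" using len by (simp add: as'_def cs'_def bs A Yq)
    thus ?thesis using x by (simp add: as'_def cs'_def bs Suc lex_append_leftI)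
  qed
  moreover have "fps_le (neg_logderiv (star_det as)) (neg_logderiv (star_det as'))"
    unfolding as2 as'_def by (rule star_det_jump(1)[OF ys q m])
  moreover have "fps_lt (neg_logderiv (star_det as)) (neg_logderiv (star_det as'))"
    if "3 \<le> length (filter (\<lambda>a. 0 < a) as)"
  proof -
    \<comment> \<open>Without \<open>ys\<close> only \<open>x\<close> and \<open>q\<close> follow
      \<open>cs'\<close>, so one of the three nonzero entries lies in \<open>cs'\<close>.\<close>
    have "sum_list (map path_end cs') \<noteq> 0" if "ys = []"
    proof
      assume "sum_list (map path_end cs') = 0"
      hence "length (filter (\<lambda>a. 0 < a) cs') = 0"
        using sum_list_path_end_nth_0[of cs'] by simp
      thus False using \<open>3 \<le> _\<close> \<open>ys = []\<close> by (simp add: as2 split: if_splits)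
    qed
    thus ?thesis unfolding as2 as'_def using star_det_jump(2)[OF ys q m qx] by blast
  qed
  ultimately show thesis by (rule that)
qed

text \<open>Elementary steps are iterated; the number of lists of the given length and sum
  lexicographically above the current one is finite and drops, since \<open>as'\<close> itself
  leaves the set.\<close>

lemma star_det_lex_le:
  fixes as bs :: "nat list"
  assumes "sorted as" "sorted bs" "sum_list as = sum_list bs" "(as, bs) \<in> lex less_than"
  shows "fps_le (neg_logderiv (star_det as)) (neg_logderiv (star_det bs))"
  using assms
proof (induction "card {ds. length ds = length bs \<and> sum_list ds = sum_list bs \<and> (as, ds) \<in> lex less_than}"
    arbitrary: as rule: less_induct)
  case less
  let ?S = "\<lambda>as. {ds. length ds = length bs \<and> sum_list ds = sum_list bs \<and> (as, ds) \<in> lex less_than}"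
  obtain as' where as': "sorted as'" "length as' = length as" "sum_list as' = sum_list as"
    "(as, as') \<in> lex less_than" "as' = bs \<or> (as', bs) \<in> lex less_than"
    "fps_le (neg_logderiv (star_det as)) (neg_logderiv (star_det as'))"
    using star_det_lex_step[OF less.prems] by metis
  have len: "length as = length bs" using less.prems(4) by (auto simp: lex_conv)
  have trans: "trans (lex less_than)" by (simp add: lex_transI)
  have "?S as \<subseteq> {ds. set ds \<subseteq> {..sum_list bs} \<and> length ds = length bs}"
    using member_le_sum_list[where ?'a = nat] by fastforce
  hence "finite (?S as)"
    using finite_subset finite_lists_length_eq[of "{..sum_list bs}" "length bs"] by auto
  moreover have "?S as' \<subset> ?S as"
  proof
    show "?S as' \<subseteq> ?S as" using as'(4) trans by (auto dest: transD)
    have "(as', as') \<notin> lex less_than" by (simp add: wf_lex wf_not_refl)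
    hence "as' \<in> ?S as" "as' \<notin> ?S as'" using as' len less.prems(3) by auto
    thus "?S as' \<noteq> ?S as" by blast
  qed
  ultimately have card: "card (?S as') < card (?S as)" by (rule psubset_card_mono)
  have "fps_le (neg_logderiv (star_det as')) (neg_logderiv (star_det bs))"
  proof (cases "as' = bs")
    case False
    thus ?thesis using as' less.hyps[OF card] less.prems by auto
  qed simp
  thus ?case using as'(6) fps_le_trans by blast
qed

text \<open>A strict first step suffices; the rest of the chain only has to be monotone.\<close>

lemma star_det_lex_less:
  fixes as bs :: "nat list"
  assumes "sorted as" "sorted bs" "sum_list as = sum_list bs" "(as, bs) \<in> lex less_than"
    and "3 \<le> length (filter (\<lambda>a. 0 < a) as)"
  shows "fps_lt (neg_logderiv (star_det as)) (neg_logderiv (star_det bs))"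
proof -
  obtain as' where as': "sorted as'" "sum_list as' = sum_list as"
    "as' = bs \<or> (as', bs) \<in> lex less_than"
    "fps_lt (neg_logderiv (star_det as)) (neg_logderiv (star_det as'))"
    using star_det_lex_step[OF assms(1-4)] assms(5) by metis
  hence "fps_le (neg_logderiv (star_det as')) (neg_logderiv (star_det bs))"
    using star_det_lex_le[of as' bs] assms by auto
  thus ?thesis using as'(4) fps_lt_le_trans by blast
qed

section \<open>Walk generating functions\<close>

fun num_walks :: "'a set \<Rightarrow> ('a \<Rightarrow> 'a \<Rightarrow> bool) \<Rightarrow> nat \<Rightarrow> 'a \<Rightarrow> 'a \<Rightarrow> nat" where
  "num_walks V E 0 u w = (if u = w then 1 else 0)"
| "num_walks V E (Suc k) u w = (\<Sum>z | z \<in> V \<and> E u z. num_walks V E k z w)"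

definition walks_from_to :: "'a set \<Rightarrow> ('a \<Rightarrow> 'a \<Rightarrow> bool) \<Rightarrow> nat \<Rightarrow> 'a \<Rightarrow> 'a \<Rightarrow> 'a list set" where
  "walks_from_to V E k u w = {xs. length xs = Suc k \<and> set xs \<subseteq> V \<and>
      (\<forall>i<k. E (xs ! i) (xs ! Suc i)) \<and> hd xs = u \<and> last xs = w}"

lemma finite_walks_from_to: "finite V \<Longrightarrow> finite (walks_from_to V E k u w)"
  by (rule finite_subset[OF _ finite_lists_length_eq[of V "Suc k"]])
     (auto simp: walks_from_to_def)

lemma walks_from_to_Suc:
  assumes "u \<in> V"
  shows "walks_from_to V E (Suc k) u w =
    (\<Union>z\<in>{z \<in> V. E u z}. (#) u ` walks_from_to V E k z w)" (is "?L = ?R")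
proof (intro equalityI subsetI)
  fix xs assume "xs \<in> ?L"
  then obtain ys where xs: "xs = u # ys" "length ys = Suc k"
    by (cases xs) (auto simp: walks_from_to_def)
  then obtain z zs where ys: "ys = z # zs" by (cases ys) auto
  have E: "E (xs ! i) (xs ! Suc i)" if "i < Suc k" for i
    using \<open>xs \<in> ?L\<close> that by (auto simp: walks_from_to_def)
  have "E u z" using E[of 0] by (simp add: xs ys)
  moreover have "E (ys ! i) (ys ! Suc i)" if "i < k" for i
    using E[of "Suc i"] that by (simp add: xs)
  ultimately show "xs \<in> ?R"
    using \<open>xs \<in> ?L\<close> unfolding xs ys by (auto simp: walks_from_to_def xs ys)
next
  fix xs assume "xs \<in> ?R"
  then obtain z ys where z: "z \<in> V" "E u z" "xs = u # ys" "ys \<in> walks_from_to V E k z w"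
    by auto
  then obtain zs where ys: "ys = z # zs"
    by (cases ys) (auto simp: walks_from_to_def)
  have "E (xs ! i) (xs ! Suc i)" if "i < Suc k" for i
    using z that ys by (cases i) (auto simp: walks_from_to_def)
  thus "xs \<in> ?L" using z ys assms by (auto simp: walks_from_to_def)
qed

lemma card_walks_from_to:
  assumes "finite V" "u \<in> V"
  shows "card (walks_from_to V E k u w) = num_walks V E k u w"
  using assms(2)
proof (induction k arbitrary: u)
  case 0
  have "walks_from_to V E 0 u w = (if u = w then {[u]} else {})"
    using 0 by (auto simp: walks_from_to_def length_Suc_conv)
  thus ?case by simp
next
  case (Suc k)
  have "card (walks_from_to V E (Suc k) u w)
      = (\<Sum>z | z \<in> V \<and> E u z. card ((#) u ` walks_from_to V E k z w))"
    unfolding walks_from_to_Suc[OF Suc.prems]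
    by (rule card_UN_disjoint)
      (use assms in \<open>auto simp: finite_walks_from_to\<close>, auto simp: walks_from_to_def)
  also have "\<dots> = num_walks V E (Suc k) u w"
    using Suc.IH by (simp add: card_image)
  finally show ?case .
qed

lemma M_eq_sum_num_walks:
  assumes "finite V"
  shows "M V E k = (\<Sum>u\<in>V. num_walks V E k u u)"
proof -
  have "closed_walks V E k = (\<Union>u\<in>V. walks_from_to V E k u u)"
    by (auto simp: closed_walks_def walks_from_to_def dest!: hd_in_set[rotated])
       (metis hd_in_set length_0_conv nat.simps(3) subsetD)+
  hence "M V E k = (\<Sum>u\<in>V. card (walks_from_to V E k u u))"
    unfolding M_def
    by simp (rule card_UN_disjoint, use assms in \<open>auto simp: finite_walks_from_to\<close>,
        auto simp: walks_from_to_def)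
  thus ?thesis using assms by (simp add: card_walks_from_to)
qed

lemma num_walks_add:
  assumes "finite V" "u \<in> V"
  shows "num_walks V E (i + j) u w = (\<Sum>z\<in>V. num_walks V E i u z * num_walks V E j z w)"
  using assms(2)
proof (induction i arbitrary: u)
  case 0
  have "(\<Sum>z\<in>V. num_walks V E 0 u z * num_walks V E j z w)
      = (\<Sum>z\<in>V. if u = z then num_walks V E j z w else 0)"
    by (intro sum.cong) auto
  thus ?case using 0 assms by simp
next
  case (Suc i)
  have "num_walks V E (Suc i + j) u w
      = (\<Sum>y | y \<in> V \<and> E u y. \<Sum>z\<in>V. num_walks V E i y z * num_walks V E j z w)"
    using Suc.IH by simp
  also have "\<dots> = (\<Sum>z\<in>V. num_walks V E (Suc i) u z * num_walks V E j z w)"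
    by (subst sum.swap) (simp add: sum_distrib_right)
  finally show ?case .
qed

section \<open>Entries of the resolvent of the adjacency matrix and deletion of a vertex\<close>

definition walk_fps :: "'a set \<Rightarrow> ('a \<Rightarrow> 'a \<Rightarrow> bool) \<Rightarrow> 'a \<Rightarrow> 'a \<Rightarrow> real fps" where
  "walk_fps V E u w = Abs_fps (\<lambda>k. real (num_walks V E k u w))"

definition closed_walk_fps :: "'a set \<Rightarrow> ('a \<Rightarrow> 'a \<Rightarrow> bool) \<Rightarrow> real fps" where
  "closed_walk_fps V E = (\<Sum>u\<in>V. walk_fps V E u u)"

lemma nth_closed_walk_fps: "finite V \<Longrightarrow> fps_nth (closed_walk_fps V E) k = real (M V E k)"
  by (simp add: closed_walk_fps_def fps_sum_nth walk_fps_def M_eq_sum_num_walks)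

lemma walk_fps_rec:
  "walk_fps V E u w = (if u = w then 1 else 0) + fps_X * (\<Sum>z | z \<in> V \<and> E u z. walk_fps V E z w)"
proof (rule fps_ext)
  fix n show "fps_nth (walk_fps V E u w) n = fps_nth ((if u = w then 1 else 0)
      + fps_X * (\<Sum>z | z \<in> V \<and> E u z. walk_fps V E z w)) n"
    by (cases n) (auto simp: walk_fps_def fps_sum_nth)
qed

text \<open>The factor \<open>fps_X\<close> makes each coefficient depend on earlier ones only.
  Explicit formulas can thus be verified by checking a linear system instead of counting
  walks.\<close>

lemma walk_fps_unique:
  assumes "\<And>u. u \<in> V \<Longrightarrow>
    Y u = (if u = w then 1 else 0) + fps_X * (\<Sum>z | z \<in> V \<and> E u z. Y z)"
    and "u \<in> V"
  shows "walk_fps V E u w = Y u"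
proof (rule fps_ext)
  fix n
  show "fps_nth (walk_fps V E u w) n = fps_nth (Y u) n"
    using assms(2)
  proof (induction n arbitrary: u)
    case 0
    show ?case by (subst walk_fps_rec, subst assms(1)[OF 0]) simp
  next
    case (Suc n)
    show ?case
      by (subst walk_fps_rec, subst assms(1)[OF Suc.prems]) (simp add: fps_sum_nth Suc.IH)
  qed
qed

text \<open>A closed walk of length \<open>n\<close> at \<open>v\<close> can be split at
  \<open>n + 1\<close> positions, and the weight \<open>n + 1\<close> is the effect of
  \<open>1 + X d/dX\<close>.\<close>

lemma sum_walk_fps_mult:
  assumes "finite V" "v \<in> V"
  shows "(\<Sum>u\<in>V. walk_fps V E v u * walk_fps V E u v)
    = walk_fps V E v v + fps_X * fps_deriv (walk_fps V E v v)"
proof (rule fps_ext)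
  fix n
  have "fps_nth (\<Sum>u\<in>V. walk_fps V E v u * walk_fps V E u v) n
      = (\<Sum>i=0..n. real (\<Sum>u\<in>V. num_walks V E i v u * num_walks V E (n - i) u v))"
    by (simp add: fps_sum_nth fps_mult_nth walk_fps_def) (rule sum.swap)
  also have "\<dots> = (\<Sum>i=0..n. real (num_walks V E n v v))"
    using num_walks_add[OF assms, of E] by (intro sum.cong refl) (metis atLeastAtMost_iff le_add_diff_inverse)
  finally show "fps_nth (\<Sum>u\<in>V. walk_fps V E v u * walk_fps V E u v) n
      = fps_nth (walk_fps V E v v + fps_X * fps_deriv (walk_fps V E v v)) n"
    by (cases n) (auto simp: walk_fps_def algebra_simps)
qed

text \<open>Schur complement: the walks through \<open>v\<close> are subtracted. The candidate
  \<open>Y\<close> vanishes at \<open>v\<close>, so it solves the system of the smaller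
  graph.\<close>

lemma walk_fps_delete:
  assumes "finite V" "v \<in> V" "u \<in> V - {v}" "w \<noteq> v"
  shows "walk_fps (V - {v}) E u w =
    walk_fps V E u w - walk_fps V E u v * walk_fps V E v w * inverse (walk_fps V E v v)"
proof -
  let ?g = "walk_fps V E v v"
  define c where "c = walk_fps V E v w * inverse ?g"
  have g0: "fps_nth ?g 0 = 1" by (simp add: walk_fps_def)
  have c: "?g * c = walk_fps V E v w"
    using inverse_mult_eq_1[of ?g] g0 by (simp add: c_def ac_simps)
  define Y where "Y = (\<lambda>u. walk_fps V E u w - walk_fps V E u v * c)"
  have "walk_fps (V - {v}) E u w = Y u"
  proof (rule walk_fps_unique[OF _ assms(3)])
    fix u assume u: "u \<in> V - {v}"
    have "(\<Sum>z | z \<in> V \<and> E u z. Y z) = (\<Sum>z | z \<in> V - {v} \<and> E u z. Y z)"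
      by (rule sum.mono_neutral_right) (use assms c in \<open>auto simp: Y_def\<close>)
    hence sum_Y: "(\<Sum>z | z \<in> V - {v} \<and> E u z. Y z)
        = (\<Sum>z | z \<in> V \<and> E u z. walk_fps V E z w) - (\<Sum>z | z \<in> V \<and> E u z. walk_fps V E z v) * c"
      by (simp add: Y_def sum_subtractf sum_distrib_right)
    show "Y u = (if u = w then 1 else 0) + fps_X * (\<Sum>z | z \<in> V - {v} \<and> E u z. Y z)"
      unfolding sum_Y unfolding Y_def
      by (subst (1) walk_fps_rec, subst (2) walk_fps_rec) (use u in \<open>simp add: algebra_simps\<close>)
  qed
  thus ?thesis by (simp add: Y_def c_def mult.assoc)
qed

text \<open>The diagonal term of the deletion formula vanishes at \<open>v\<close> too, so the sum
  may run over all of \<open>V\<close>, where \<open>sum_walk_fps_mult\<close> evaluates it.\<close>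

lemma closed_walk_fps_delete:
  fixes E :: "'a \<Rightarrow> 'a \<Rightarrow> bool"
  assumes "finite V" "v \<in> V"
  defines "g \<equiv> walk_fps V E v v"
  shows "closed_walk_fps V E = closed_walk_fps (V - {v}) E + 1 + fps_X * fps_deriv g * inverse g"
proof -
  have g0: "fps_nth g 0 = 1" by (simp add: g_def walk_fps_def)
  hence g: "g * inverse g = 1" using inverse_mult_eq_1[of g] by (simp add: mult.commute)
  have "closed_walk_fps (V - {v}) E
      = (\<Sum>u\<in>V - {v}. walk_fps V E u u - walk_fps V E v u * walk_fps V E u v * inverse g)"
    unfolding closed_walk_fps_def g_def
    by (intro sum.cong refl) (subst walk_fps_delete[OF assms(1,2)], auto simp: ac_simps)
  also have "\<dots> = (\<Sum>u\<in>V. walk_fps V E u u - walk_fps V E v u * walk_fps V E u v * inverse g)"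
    by (rule sum.mono_neutral_left) (use assms g in \<open>auto simp: mult.assoc\<close>)
  also have "\<dots> = closed_walk_fps V E - (g + fps_X * fps_deriv g) * inverse g"
    unfolding g_def sum_walk_fps_mult[OF assms(1,2), symmetric]
    by (simp add: closed_walk_fps_def sum_subtractf sum_distrib_right)
  finally show ?thesis using g by (simp add: algebra_simps)
qed

section \<open>Closed walks of starlike trees\<close>

text \<open>The vertex sets that occur when the branches are deleted vertex by vertex from the center outwards.\<close>

definition branches_beyond :: "nat list \<Rightarrow> (nat \<Rightarrow> nat) \<Rightarrow> svert set" where
  "branches_beyond as b = {Br i j | i j. i < length as \<and> b i < j \<and> j \<le> as ! i}"

lemma finite_star_V: "finite (star_V as)"
proof -
  have "star_V as = insert Center ((\<lambda>(i, j). Br i j) ` (SIGMA i:{..<length as}. {1..as ! i}))"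
    by (force simp: star_V_def)
  thus ?thesis by simp
qed

lemma finite_branches_beyond: "finite (branches_beyond as b)"
  by (rule finite_subset[OF _ finite_star_V[of as]]) (auto simp: branches_beyond_def star_V_def)

lemma closed_walk_fps_delete_eq:
  assumes "finite V" "v \<in> V" "walk_fps V E v v = g"
  shows "closed_walk_fps V E = closed_walk_fps (V - {v}) E + 1 - neg_logderiv g"
  using closed_walk_fps_delete[OF assms(1,2)] assms(3) by (simp add: neg_logderiv_def)

lemma walk_fps_branches_beyond:
  assumes "i < length as" "b i < as ! i"
  shows "walk_fps (branches_beyond as b) (star_E as) (Br i (Suc (b i))) (Br i (Suc (b i)))
    = path_det (as ! i - Suc (b i)) * inverse (path_det (as ! i - b i))"
proof -
  define I where "I = inverse (path_det (as ! i - b i))"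
  \<comment> \<open>Cramer's rule on a path: the entry between the end vertex and a vertex at
    distance \<open>k\<close> is \<open>X^k\<close> times the determinant of the part beyond, over
    the whole determinant.\<close>
  define Y where "Y = (\<lambda>u. case u of Center \<Rightarrow> 0 | Br i' j \<Rightarrow>
    if i' = i then fps_X ^ (j - Suc (b i)) * path_det (as ! i - j) * I else 0)"
  have I: "path_det (as ! i - b i) * I = 1" by (simp add: I_def)
  have "walk_fps (branches_beyond as b) (star_E as) (Br i (Suc (b i))) (Br i (Suc (b i)))
      = Y (Br i (Suc (b i)))"
  proof (rule walk_fps_unique)
    show "Br i (Suc (b i)) \<in> branches_beyond as b"
      using assms by (auto simp: branches_beyond_def)
  next
    fix u assume "u \<in> branches_beyond as b"
    then obtain i' j where u: "u = Br i' j" "i' < length as" "b i' < j" "j \<le> as ! i'"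
      by (auto simp: branches_beyond_def)
    have nbrs: "{z \<in> branches_beyond as b. star_E as u z} =
      (if Suc (b i') < j then {Br i' (j - 1)} else {}) \<union> (if j < as ! i' then {Br i' (Suc j)} else {})"
      using u by (auto simp: branches_beyond_def star_E_def star_edge_def)
    have sum: "(\<Sum>z | z \<in> branches_beyond as b \<and> star_E as u z. Y z) =
      (if Suc (b i') < j then Y (Br i' (j - 1)) else 0) + (if j < as ! i' then Y (Br i' (Suc j)) else 0)"
      unfolding nbrs by auto
    show "Y u = (if u = Br i (Suc (b i)) then 1 else 0)
      + fps_X * (\<Sum>z | z \<in> branches_beyond as b \<and> star_E as u z. Y z)"
    proof (cases "i' = i")
      case False
      thus ?thesis unfolding sum using u by (simp add: Y_def)
    next
      case True
      obtain k where k: "j = Suc (b i + k)" using u True less_imp_Suc_add by blast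
      define d where "d = as ! i - j"
      have a: "as ! i = d + j" using u True by (simp add: d_def)
      \<comment> \<open>At the tip of the branch \<open>d = 0\<close>: there is no outer neighbour,
        and \<open>path_det 0 = path_det 1\<close>.\<close>
      have rec: "path_det d = path_det (Suc d) + (if 0 < d then fps_X ^ 2 * path_det (d - 1) else 0)"
        by (cases d) auto
      have I': "path_det (Suc (d + k)) * I = 1" using I by (simp add: a k add.commute)
      show ?thesis
      proof (cases k)
        case 0
        have "path_det d * I = path_det (Suc d) * I + fps_X * (if 0 < d then fps_X * path_det (d - 1) * I else 0)"
          by (subst rec) (simp add: algebra_simps power2_eq_square)
        thus ?thesis unfolding sum using I' by (simp add: Y_def u(1) True a k 0)
      next
        case (Suc l)
        have "fps_X ^ k * path_det d * I = fps_X * (fps_X ^ l * path_det (Suc d) * I)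
            + fps_X * (if 0 < d then fps_X ^ Suc k * path_det (d - 1) * I else 0)"
          by (subst rec) (simp add: algebra_simps power2_eq_square Suc)
        thus ?thesis unfolding sum
          by (simp add: Y_def u(1) True a k Suc Suc_diff_le distrib_left)
      qed
    qed
  qed
  thus ?thesis by (simp add: Y_def I_def)
qed

text \<open>Deleting the innermost remaining vertex of a branch shortens its path by one; the
  logarithmic derivatives of the determinant ratios telescope.\<close>

lemma closed_walk_fps_branches_beyond:
  "closed_walk_fps (branches_beyond as b) (star_E as)
    = (\<Sum>i<length as. of_nat (as ! i - b i) + neg_logderiv (path_det (as ! i - b i)))"
proof (induction "\<Sum>i<length as. as ! i - b i" arbitrary: b rule: less_induct)
  case less
  show ?case
  proof (cases "\<exists>i<length as. b i < as ! i")
    case False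
    hence "branches_beyond as b = {}" by (force simp: branches_beyond_def)
    moreover have "as ! i - b i = 0" if "i < length as" for i using False that by force
    ultimately show ?thesis by (simp add: closed_walk_fps_def neg_logderiv_def)
  next
    case True
    then obtain i where i: "i < length as" "b i < as ! i" by blast
    define b' where "b' = b(i := Suc (b i))"
    let ?v = "Br i (Suc (b i))"
    let ?t = "\<lambda>b i. of_nat (as ! i - b i) + neg_logderiv (path_det (as ! i - b i))"
    have v: "?v \<in> branches_beyond as b" using i by (auto simp: branches_beyond_def)
    have del: "branches_beyond as b - {?v} = branches_beyond as b'"
      by (auto simp: branches_beyond_def b'_def split: if_splits) (metis Suc_lessI)+
    have split: "(\<Sum>l<length as. f l) = f i + (\<Sum>l\<in>{..<length as} - {i}. f l)"
      for f :: "nat \<Rightarrow> 'c :: comm_monoid_add"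
      using i by (subst sum.remove[of _ i]) auto
    have "(\<Sum>l<length as. as ! l - b' l) < (\<Sum>l<length as. as ! l - b l)"
      by (rule sum_strict_mono_ex1) (use i in \<open>auto simp: b'_def\<close>)
    hence IH: "closed_walk_fps (branches_beyond as b') (star_E as) = (\<Sum>l<length as. ?t b' l)"
      by (rule less)
    have "closed_walk_fps (branches_beyond as b) (star_E as) = (\<Sum>l<length as. ?t b' l) + 1
        - neg_logderiv (path_det (as ! i - Suc (b i)) * inverse (path_det (as ! i - b i)))"
      using closed_walk_fps_delete_eq[OF finite_branches_beyond v walk_fps_branches_beyond[where b = b, OF i]]
      unfolding del IH .
    also have "neg_logderiv (path_det (as ! i - Suc (b i)) * inverse (path_det (as ! i - b i)))
        = neg_logderiv (path_det (as ! i - Suc (b i))) - neg_logderiv (path_det (as ! i - b i))"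
      by (simp add: neg_logderiv_mult neg_logderiv_inverse)
    also have "(\<Sum>l<length as. ?t b' l) = ?t b' i + (\<Sum>l\<in>{..<length as} - {i}. ?t b l)"
      by (subst split) (simp add: b'_def)
    finally show ?thesis
      using i by (subst split) (simp add: b'_def of_nat_diff algebra_simps)
  qed
qed

lemma walk_fps_center:
  "walk_fps (star_V as) (star_E as) Center Center = inverse (1 - fps_X ^ 2 * sum_list (map path_end as))"
proof -
  let ?S = "sum_list (map path_end as)"
  define g where "g = inverse (1 - fps_X ^ 2 * ?S)"
  have "g * (1 - fps_X ^ 2 * ?S) = 1" unfolding g_def by (rule inverse_mult_eq_1) simp
  hence g: "g = 1 + fps_X ^ 2 * ?S * g" by (simp add: algebra_simps)
  \<comment> \<open>A walk from a branch to the center is a path entry as in Cramer's rule followed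
    by a closed walk at the center, counted by \<open>g\<close>.\<close>
  define Y where "Y = (\<lambda>u. case u of Center \<Rightarrow> g | Br i j \<Rightarrow>
    fps_X ^ j * path_det (as ! i - j) * (inverse (path_det (as ! i)) * g))"
  have "walk_fps (star_V as) (star_E as) Center Center = Y Center"
  proof (rule walk_fps_unique)
    show "Center \<in> star_V as" by (simp add: star_V_def)
  next
    fix u assume "u \<in> star_V as"
    then consider "u = Center" | i j where "u = Br i j" "i < length as" "1 \<le> j" "j \<le> as ! i"
      by (auto simp: star_V_def)
    thus "Y u = (if u = Center then 1 else 0) + fps_X * (\<Sum>z | z \<in> star_V as \<and> star_E as u z. Y z)"
    proof cases
      case 1
      have "{z \<in> star_V as. star_E as u z} = (\<lambda>i. Br i 1) ` {i \<in> {..<length as}. 1 \<le> as ! i}"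
        using 1 by (auto simp: star_V_def star_E_def star_edge_def)
      hence "(\<Sum>z | z \<in> star_V as \<and> star_E as u z. Y z)
          = (\<Sum>i\<in>{i \<in> {..<length as}. 1 \<le> as ! i}. Y (Br i 1))"
        by (simp add: sum.reindex inj_on_def)
      also have "\<dots> = (\<Sum>i\<in>{i \<in> {..<length as}. 1 \<le> as ! i}. fps_X * path_end (as ! i) * g)"
      proof (rule sum.cong)
        fix i assume "i \<in> {i \<in> {..<length as}. 1 \<le> as ! i}"
        then obtain a where "as ! i = Suc a" by (cases "as ! i") auto
        thus "Y (Br i 1) = fps_X * path_end (as ! i) * g" by (simp add: Y_def path_end_Suc ac_simps)
      qed simp
      \<comment> \<open>Empty branches may be added because \<open>path_end 0 = 0\<close>.\<close>
      also have "\<dots> = (\<Sum>i<length as. fps_X * path_end (as ! i) * g)"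
        by (rule sum.mono_neutral_left) (auto simp: not_le)
      also have "\<dots> = fps_X * ?S * g"
        by (simp add: sum_list_sum_nth atLeast0LessThan sum_distrib_left sum_distrib_right)
      finally show ?thesis using g 1 by (simp add: Y_def power2_eq_square mult.assoc)
    next
      case (2 i j)
      define a where "a = as ! i"
      define I where "I = inverse (path_det a) * g"
      obtain k where k: "j = Suc k" using 2 by (cases j) auto
      obtain d where d: "a = d + j" using 2 by (metis a_def le_add_diff_inverse2)
      have nbrs: "{z \<in> star_V as. star_E as u z} =
        {if k = 0 then Center else Br i k} \<union> (if j < a then {Br i (Suc j)} else {})"
        using 2 by (auto simp: star_V_def star_E_def star_edge_def k a_def)
      have "(\<Sum>z | z \<in> star_V as \<and> star_E as u z. Y z)
        = Y (if k = 0 then Center else Br i k) + (if j < a then Y (Br i (Suc j)) else 0)"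
        unfolding nbrs by (auto simp: k)
      \<comment> \<open>The branch formula at \<open>k = 0\<close> gives \<open>g\<close>, so the
        center needs no separate treatment as inner neighbour.\<close>
      also have "Y (if k = 0 then Center else Br i k) = fps_X ^ k * path_det (a - k) * I"
        by (auto simp: Y_def a_def I_def simp flip: mult.assoc)
      also have "(if j < a then Y (Br i (Suc j)) else 0)
        = (if 0 < d then fps_X ^ Suc j * path_det (d - 1) * I else 0)"
        by (auto simp: Y_def a_def[symmetric] I_def d)
      finally have sum: "(\<Sum>z | z \<in> star_V as \<and> star_E as u z. Y z)
        = fps_X ^ k * path_det (Suc d) * I + (if 0 < d then fps_X ^ Suc j * path_det (d - 1) * I else 0)"
        by (simp add: d k)
      have rec: "path_det d = path_det (Suc d) + (if 0 < d then fps_X ^ 2 * path_det (d - 1) else 0)"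
        by (cases d) auto
      have "Y u = fps_X ^ j * path_det d * I"
        by (simp add: Y_def 2(1) a_def[symmetric] I_def d)
      also have "\<dots> = fps_X * (\<Sum>z | z \<in> star_V as \<and> star_E as u z. Y z)"
        unfolding sum by (subst rec) (simp add: algebra_simps power2_eq_square k)
      finally show ?thesis using 2 by simp
    qed
  qed
  thus ?thesis by (simp add: Y_def g_def)
qed

lemma neg_logderiv_prod_list_path_det:
  "neg_logderiv (prod_list (map path_det as)) = (\<Sum>a\<leftarrow>as. neg_logderiv (path_det a))"
  by (induction as) (auto simp: neg_logderiv_mult, simp add: neg_logderiv_def)

lemma closed_walk_fps_star:
  "closed_walk_fps (star_V as) (star_E as) = 1 + of_nat (sum_list as) + neg_logderiv (star_det as)"
proof -
  have del: "star_V as - {Center} = branches_beyond as (\<lambda>_. 0)"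
    by (auto simp: star_V_def branches_beyond_def)
  have "Center \<in> star_V as" by (simp add: star_V_def)
  hence "closed_walk_fps (star_V as) (star_E as)
      = (\<Sum>i<length as. of_nat (as ! i) + neg_logderiv (path_det (as ! i))) + 1
        + neg_logderiv (1 - fps_X ^ 2 * sum_list (map path_end as))"
    using closed_walk_fps_delete_eq[OF finite_star_V _ walk_fps_center, of as]
      closed_walk_fps_branches_beyond[of as "\<lambda>_. 0"]
    by (simp add: neg_logderiv_inverse del)
  also have "(\<Sum>i<length as. of_nat (as ! i) + neg_logderiv (path_det (as ! i)))
      = of_nat (sum_list as) + neg_logderiv (prod_list (map path_det as))"
    unfolding neg_logderiv_prod_list_path_det
    by (simp add: sum.distrib sum_list_sum_nth atLeast0LessThan)
  finally show ?thesis by (simp add: star_det_def neg_logderiv_mult)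
qed

section \<open>Comparison of starlike trees in shortlex order\<close>

lemma walk_prec_star_iff:
  assumes "sum_list as = sum_list bs"
  shows "walk_prec (star_V as) (star_E as) (star_V bs) (star_E bs)
    \<longleftrightarrow> fps_lt (neg_logderiv (star_det as)) (neg_logderiv (star_det bs))"
proof -
  let ?c = "1 + of_nat (sum_list bs) :: real fps"
  have M: "real (M (star_V as) (star_E as) k) = fps_nth ?c k + fps_nth (neg_logderiv (star_det as)) k"
    if "sum_list as = sum_list bs" for as k
    using nth_closed_walk_fps[OF finite_star_V, of as "star_E as" k] that
    by (simp add: closed_walk_fps_star)
  have le: "M (star_V as) (star_E as) k \<le> M (star_V bs) (star_E bs) k
      \<longleftrightarrow> fps_nth (neg_logderiv (star_det as)) k \<le> fps_nth (neg_logderiv (star_det bs)) k" for k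
    using M[OF assms, of k] M[OF refl, of k] by linarith
  have less: "M (star_V as) (star_E as) k < M (star_V bs) (star_E bs) k
      \<longleftrightarrow> fps_nth (neg_logderiv (star_det as)) k < fps_nth (neg_logderiv (star_det bs)) k" for k
    using M[OF assms, of k] M[OF refl, of k] by linarith
  show ?thesis
    unfolding walk_prec_def walk_preceq_def le less fps_lt_def fps_le_iff fps_eq_iff
    by (metis less_le)
qed

lemma star_det_replicate_0_append: "star_det (replicate k 0 @ as) = star_det as"
  by (induction k) (auto simp: star_det_def)

lemma star_det_shortlex_less:
  assumes "sorted as" "\<forall>a\<in>set as. 1 \<le> a" "3 \<le> length as"
    and "sorted bs" "\<forall>b\<in>set bs. 1 \<le> b"
    and "sum_list as = sum_list bs" "shortlex_less as bs"
  shows "fps_lt (neg_logderiv (star_det as)) (neg_logderiv (star_det bs))"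
proof -
  define as0 where "as0 = replicate (length bs - length as) 0 @ as"
  have len: "length as < length bs \<or> length as = length bs \<and> (as, bs) \<in> lex less_than"
    using assms(7) by (auto simp: shortlex_less_def lenlex_conv)
  have "(as0, bs) \<in> lex less_than"
  \<comment> \<open>If \<open>as\<close> is shorter, its padded form starts with \<open>0\<close>,
    below the positive head of \<open>bs\<close>; for equal lengths the padding is empty.\<close>
  proof (cases "length as < length bs")
    case True
    then obtain k where k: "length bs - length as = Suc k" by (metis Suc_diff_Suc)
    obtain b bs' where b: "bs = b # bs'" using True by (cases bs) auto
    have "length (replicate k 0 @ as) = length bs'" using k b by simp
    moreover have "0 < b" using assms(5) b by auto
    ultimately show ?thesis unfolding as0_def k unfolding b by simp
  qed (use len in \<open>auto simp: as0_def\<close>)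
  moreover have "filter (\<lambda>a. 0 < a) as = as" using assms(2) by (simp add: Suc_le_eq)
  ultimately have "fps_lt (neg_logderiv (star_det as0)) (neg_logderiv (star_det bs))"
    using assms by (intro star_det_lex_less) (auto simp: as0_def sorted_append sum_list_replicate)
  thus ?thesis by (simp add: as0_def star_det_replicate_0_append)
qed

theorem theorem1:
  fixes n :: nat and as bs :: "nat list"
  assumes "sorted as" and "\<forall>a\<in>set as. 1 \<le> a" and "length as \<ge> 3" and "sum_list as = n"
      and "sorted bs" and "\<forall>b\<in>set bs. 1 \<le> b" and "length bs \<ge> 3" and "sum_list bs = n"
  shows "walk_prec (star_V as) (star_E as) (star_V bs) (star_E bs) \<longleftrightarrow> shortlex_less as bs"
proof -
  have sum: "sum_list as = sum_list bs" using assms by simp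
  have lt: "shortlex_less as bs \<Longrightarrow> fps_lt (neg_logderiv (star_det as)) (neg_logderiv (star_det bs))"
    and gt: "shortlex_less bs as \<Longrightarrow> fps_lt (neg_logderiv (star_det bs)) (neg_logderiv (star_det as))"
    using star_det_shortlex_less assms by auto
  \<comment> \<open>Totality yields the converse: equality or the reverse order would contradict
    antisymmetry of the coefficientwise order.\<close>
  have "as = bs \<or> shortlex_less as bs \<or> shortlex_less bs as"
    using total_lenlex[OF total_less_than] by (auto simp: shortlex_less_def total_on_def)
  thus ?thesis
    unfolding walk_prec_star_iff[OF sum] using lt gt
    by (auto simp: fps_lt_def dest: fps_le_antisym)
qed

end
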